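(* Let $R$ be an associative ring, $a\in R$, and $n$ a positive integer. Then $a$ has a $\{1^{n},3,5\}$-inverse in $R$ if and only if $a$ has a $\{1^{n},4,5\}$-inverse in $R$.
   Context: For an element $a$ of an associative ring $R$ and a positive integer $n$, consider the following equations in the unknown $x\in R$: $(1^{n})$: $a^{n}xa=a^{n}$; $(3)$: $xax=x$; $(4)$: $xax-axa=x-a$; $(5)$: $ax=xa$. For a subset $U\subseteq\{1^{n},3,4,5\}$, an element $x\in R$ is called a $U$-inverse of $a$ if $x$ satisfies equation $(i)$ for every $i\in U$. A $\{1^{n},3,5\}$-inverse is a Drazin inverse of $a$, and a $\{1^{n},4,5\}$-inverse is a complete inverse of $a$. *)

theory Defs
  imports Main
begin

(* The class ring does not assume a unit, so the library power (class power / monoid_mult) is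
   not available. Only exponents n > 0 are meaningful: for n = 0 truncated subtraction gives a. *)
definition pos_power :: "'a::semigroup_mult \<Rightarrow> nat \<Rightarrow> 'a" where
  "pos_power a n = (((*) a) ^^ (n - 1)) a"

lemma pos_power_1: "pos_power a 1 = a"
  by (simp add: pos_power_def)

lemma pos_power_Suc: "n > 0 \<Longrightarrow> pos_power a (Suc n) = a * pos_power a n"
  by (cases n) (simp_all add: pos_power_def)

lemma pos_power_eq_power:
  fixes a :: "'a::monoid_mult"
  assumes "n > 0"
  shows "pos_power a n = a ^ n"
  using assms
proof (induction n rule: nat_induct_non_zero)
  case 1
  then show ?case by (simp add: pos_power_def)
next
  case (Suc n)
  then show ?case by (simp add: pos_power_Suc)
qed

datatype inverse_eqn = Eq1 nat | Eq3 | Eq4 | Eq5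

fun satisfies_eqn :: "'a::ring \<Rightarrow> 'a \<Rightarrow> inverse_eqn \<Rightarrow> bool" where
  "satisfies_eqn a x (Eq1 n) \<longleftrightarrow> pos_power a n * x * a = pos_power a n"
| "satisfies_eqn a x Eq3 \<longleftrightarrow> x * a * x = x"
| "satisfies_eqn a x Eq4 \<longleftrightarrow> x * a * x - a * x * a = x - a"
| "satisfies_eqn a x Eq5 \<longleftrightarrow> a * x = x * a"

definition is_U_inverse :: "inverse_eqn set \<Rightarrow> 'a::ring \<Rightarrow> 'a \<Rightarrow> bool" where
  "is_U_inverse U a x \<longleftrightarrow> (\<forall>i\<in>U. satisfies_eqn a x i)"

end

(* Given a Drazin inverse d, the product e = ad is an idempotent with a^n e = a^n, and
   x = d + a - ada equals d on the e-component and a on the complementary component; it is a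
   complete inverse.  Conversely, let w = ax for a complete inverse x.  Then a^n w = a^n, and since
   w^n = x^n a^n also w^n w = w^n, so x w^n is a Drazin inverse. *)
theory Submission
  imports Defs
begin

lemma pos_power_commutes:
  fixes b c :: "'a::semigroup_mult"
  assumes "n > 0" and bc: "b * c = c * b"
  shows "pos_power b n * c = c * pos_power b n"
  using assms(1)
proof (induction n rule: nat_induct_non_zero)
  case 1
  then show ?case by (simp only: pos_power_1 bc)
next
  case (Suc n)
  then show ?case by (metis bc mult.assoc pos_power_Suc)
qed

lemma pos_power_mult_distrib:
  fixes b c :: "'a::semigroup_mult"
  assumes "n > 0" and bc: "b * c = c * b"
  shows "pos_power (b * c) n = pos_power b n * pos_power c n"
  using assms(1)
proof (induction n rule: nat_induct_non_zero)
  case 1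
  then show ?case by (simp only: pos_power_1)
next
  case (Suc n)
  have "pos_power (b * c) (Suc n) = b * (c * pos_power b n) * pos_power c n"
    using Suc by (simp add: pos_power_Suc mult.assoc)
  also have "\<dots> = b * (pos_power b n * c) * pos_power c n"
    using pos_power_commutes[OF Suc.hyps bc] by simp
  finally show ?case using Suc.hyps by (simp add: pos_power_Suc mult.assoc)
qed

text \<open>Needed both for p = a^n and for p = w^n itself; in the second case it turns w^n w = w^n
  into idempotence of w^n.\<close>

lemma mult_pos_power_absorb:
  fixes p w :: "'a::semigroup_mult"
  assumes "n > 0" and pw: "p * w = p"
  shows "p * pos_power w n = p"
  using assms(1)
proof (induction n rule: nat_induct_non_zero)
  case 1
  then show ?case by (simp only: pos_power_1 pw)
next
  case (Suc n)
  then show ?case by (metis pw mult.assoc pos_power_Suc)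
qed

lemma complete_inverse_of_Drazin_inverse:
  fixes a d :: "'a::ring"
  assumes "is_U_inverse {Eq1 n, Eq3, Eq5} a d"
  shows "is_U_inverse {Eq1 n, Eq4, Eq5} a (d + a - a * d * a)"
proof -
  define p where "p = pos_power a n"
  have pda: "p * d * a = p" and dad: "d * a * d = d" and com: "a * d = d * a"
    using assms by (auto simp: is_U_inverse_def p_def)
  define x where "x = d + a - a * d * a"
  define e where "e = a * d"
  have ee: "e * e = e" and ed: "e * d = d" and ae: "a * e = e * a" and pe: "p * e = p"
    unfolding e_def by (metis com dad mult.assoc pda)+
  have x: "x = d + a - e * a" by (simp add: x_def e_def)
  \<comment> \<open>Formally this is e + (1 - e)a^2. The ring need not have a unit, so the
    complement 1 - e appears only in expanded form.\<close>
  have ax: "a * x = e + a * a - e * (a * a)"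
    unfolding x by (simp add: distrib_left right_diff_distrib e_def[symmetric] mult.assoc[symmetric] ae)
  have xa: "x * a = e + a * a - e * (a * a)"
    unfolding x by (simp add: distrib_right left_diff_distrib com[symmetric] e_def[symmetric] mult.assoc)
  \<comment> \<open>Since pe = p, left multiplication by p kills (1 - e)a^2 and leaves pe.\<close>
  have "p * x * a = p * (x * a)" by (simp add: mult.assoc)
  also have "\<dots> = p * e + p * (a * a) - (p * e) * (a * a)"
    unfolding xa by (simp add: distrib_left right_diff_distrib mult.assoc)
  finally have 1: "p * x * a = p" by (simp add: pe)
  have eaa: "e * (a * a) = (a * a) * e" by (metis ae mult.assoc)
  have xma: "x - a = e * (d - a)" by (simp add: x right_diff_distrib ed)
  have "x * a * x - a * x * a = (x * a) * (x - a)"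
    using ax xa by (simp add: right_diff_distrib)
  also have "\<dots> = (e + a * a - e * (a * a)) * (e * (d - a))"
    by (simp only: xa xma)
  also have "\<dots> = (e * e + (a * a) * e - e * ((a * a) * e)) * (d - a)"
    by (simp add: distrib_right left_diff_distrib mult.assoc)
  also have "\<dots> = e * (d - a)"
    unfolding eaa[symmetric] by (simp add: mult.assoc[symmetric] ee)
  also have "\<dots> = x - a" by (simp only: xma)
  finally have 4: "x * a * x - a * x * a = x - a" .
  show ?thesis
    using 1 4 ax xa unfolding x_def p_def by (simp add: is_U_inverse_def)
qed

text \<open>The element w = ax need not be idempotent, so x itself may violate (3). The power w^n is
  idempotent and still fixes a^n from the right.\<close>

lemma Drazin_inverse_of_commuting_inner_inverse:
  fixes a x :: "'a::ring"
  assumes n: "n > 0" and "is_U_inverse {Eq1 n, Eq5} a x"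
  shows "is_U_inverse {Eq1 n, Eq3, Eq5} a (x * pos_power (a * x) n)"
proof -
  define p where "p = pos_power a n"
  define w where "w = a * x"
  define q where "q = pos_power w n"
  have pxa: "p * x * a = p" and com: "a * x = x * a"
    using assms(2) by (auto simp: is_U_inverse_def p_def)
  have pw: "p * w = p" by (simp add: w_def com mult.assoc[symmetric] pxa)
  have aw: "w * a = a * w" and xw: "w * x = x * w" by (metis com mult.assoc w_def)+
  have aq: "q * a = a * q" and xq: "q * x = x * q"
    unfolding q_def using pos_power_commutes n aw xw by blast+
  \<comment> \<open>Writing w as xa rather than ax puts a^n at the right end of the product, where
    \<open>pw\<close> absorbs a further factor w.\<close>
  have "q = pos_power x n * p"
    unfolding q_def w_def com p_def using n com[symmetric] by (rule pos_power_mult_distrib)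
  then have qw: "q * w = q" by (simp add: mult.assoc pw)
  have pq: "p * q = p" and qq: "q * q = q"
    unfolding q_def using mult_pos_power_absorb[OF n] pw qw[unfolded q_def] by blast+
  have "p * (x * q) * a = p * w * q"
    by (metis aq com mult.assoc w_def)
  then have 1: "p * (x * q) * a = p" by (simp add: pw pq)
  \<comment> \<open>The inner factor ax is w, which the left copy of q absorbs; idempotence of q
    then finishes (3).\<close>
  have "x * q * a * (x * q) = x * ((q * w) * q)"
    by (simp add: w_def mult.assoc)
  then have 3: "x * q * a * (x * q) = x * q" by (simp add: qw qq)
  have 5: "a * (x * q) = x * q * a" by (metis aq com mult.assoc)
  show ?thesis
    using 1 3 5 unfolding p_def q_def w_def by (simp add: is_U_inverse_def)
qed

theorem mainTheorem2:
  fixes a :: "'a::ring" and n :: nat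
  assumes "n > 0"
  shows "(\<exists>x. is_U_inverse {Eq1 n, Eq3, Eq5} a x) \<longleftrightarrow> (\<exists>x. is_U_inverse {Eq1 n, Eq4, Eq5} a x)"
proof
  show "\<exists>x. is_U_inverse {Eq1 n, Eq4, Eq5} a x" if "\<exists>x. is_U_inverse {Eq1 n, Eq3, Eq5} a x"
    using that complete_inverse_of_Drazin_inverse by blast
  show "\<exists>x. is_U_inverse {Eq1 n, Eq3, Eq5} a x" if "\<exists>x. is_U_inverse {Eq1 n, Eq4, Eq5} a x"
  proof -
    from that obtain x where "is_U_inverse {Eq1 n, Eq5} a x"
      by (auto simp: is_U_inverse_def)
    then show ?thesis
      using Drazin_inverse_of_commuting_inner_inverse[OF assms] by blast
  qed
qed

end
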